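(* Let $R$ be an associative ring with unit $1_R$ and let $I$ be an infinite set. (a) For every derivation $d$ of the ring $M_{\infty}(I,R)$ there exist a matrix $a\in M_{rcf}(I,R)$ and a derivation $u\in \mathrm{Der}(R)$ such that $d=\mathrm{ad}(a)+u$ on $M_{\infty}(I,R)$. (b) For every derivation $d$ of the ring $M(I,R)$ (respectively, of the ring $M_{rcf}(I,R)$) there exist a matrix $a\in M(I,R)$ (respectively, $a\in M_{rcf}(I,R)$) and a derivation $u\in \mathrm{Der}(R)$ such that $d=\mathrm{ad}(a)+u$ on $M(I,R)$ (respectively, on $M_{rcf}(I,R)$). Here $u\in\mathrm{Der}(R)$ acts on matrices entrywise.
   Context: For an associative (not necessarily commutative) ring $R$ with unit and an infinite set $I$: - $M(I,R)$ is the ring of $(I\times I)$-matrices over $R$ having finitely many nonzero entries in each column. - $M_{rcf}(I,R)\subseteq M(I,R)$ is the subring of all $(I\times I)$-matrices over $R$ having finitely many nonzero entries in each row and in each column. - $M_{\infty}(I,R)\subseteq M(I,R)$ is the subring (without unit) of all $(I\times I)$-matrices over $R$ having only finitely many nonzero entries. It is a two-sided ideal of $M_{rcf}(I,R)$. A derivation of an associative ring $A$ (not necessarily unital) is an additive map $d:A\to A$ with $d(xy)=d(x)y+x\,d(y)$ for all $x,y\in A$; $\mathrm{Der}(A)$ is the set of all derivations of $A$. Derivations are only assumed additive. For $a\in M(I,R)$, $\mathrm{ad}(a)$ is the map $x\mapsto [a,x]=ax-xa$; for $a\in M_{rcf}(I,R)$ it maps $M_{\infty}(I,R)$ into itself.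 A derivation $u\in \mathrm{Der}(R)$ is identified with the derivation of $M(I,R)$ obtained by applying $u$ to every entry, $(a_{ij})\mapsto (u(a_{ij}))$; this leaves $M_{rcf}(I,R)$ and $M_{\infty}(I,R)$ invariant, and so also gives derivations of these rings. *)

theory Defs
  imports "HOL-Library.Groups_Big_Fun" "HOL-Library.Function_Algebras"
begin

text \<open>
  An \<open>I \<times> I\<close>-matrix over \<open>R\<close> is a function \<open>'i \<Rightarrow> 'i \<Rightarrow> 'r\<close> (row index first) that vanishes outside
  \<open>I \<times> I\<close>. Addition and subtraction of matrices are the pointwise operations on functions. The
  pointwise product of functions is never used; the product of matrices is \<open>mat_mult\<close>.

  The coefficients have sort \<open>{ring, monoid_mult}\<close>, i.e. they form an associative ring with unit.
  The class \<open>ring_1\<close> would in addition exclude the zero ring.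
\<close>

type_synonym ('i, 'r) mat = "'i \<Rightarrow> 'i \<Rightarrow> 'r"

definition matrices :: "'i set \<Rightarrow> ('i, 'r::zero) mat set" where
  "matrices I = {a. \<forall>i j. a i j \<noteq> 0 \<longrightarrow> i \<in> I \<and> j \<in> I}"

definition M_cf :: "'i set \<Rightarrow> ('i, 'r::zero) mat set" where
  "M_cf I = {a \<in> matrices I. \<forall>j. finite {i. a i j \<noteq> 0}}"

definition M_rcf :: "'i set \<Rightarrow> ('i, 'r::zero) mat set" where
  "M_rcf I = {a \<in> matrices I. (\<forall>i. finite {j. a i j \<noteq> 0}) \<and> (\<forall>j. finite {i. a i j \<noteq> 0})}"

definition M_fin :: "'i set \<Rightarrow> ('i, 'r::zero) mat set" where
  "M_fin I = {a \<in> matrices I. finite {(i, j). a i j \<noteq> 0}}"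

text \<open>
  \<open>Sum_any\<close> sums a function over its support. For \<open>b\<close> in \<open>M_cf I\<close> the support is finite below.
\<close>

definition mat_mult :: "('i, 'r::semiring_0) mat \<Rightarrow> ('i, 'r) mat \<Rightarrow> ('i, 'r) mat" where
  "mat_mult a b = (\<lambda>i j. Sum_any (\<lambda>k. a i k * b k j))"

text \<open>
  Derivations of the (not necessarily unital) ring with underlying set \<open>A\<close>, addition \<open>+\<close> and
  multiplication \<open>m\<close>. Only the restriction of \<open>d\<close> to \<open>A\<close> matters.
\<close>

definition Der :: "'a::plus set \<Rightarrow> ('a \<Rightarrow> 'a \<Rightarrow> 'a) \<Rightarrow> ('a \<Rightarrow> 'a) set" where
  "Der A m = {d. d ` A \<subseteq> A \<and>
     (\<forall>x\<in>A. \<forall>y\<in>A. d (x + y) = d x + d y) \<and>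
     (\<forall>x\<in>A. \<forall>y\<in>A. d (m x y) = m (d x) y + m x (d y))}"

definition ad :: "('i, 'r::ring) mat \<Rightarrow> ('i, 'r) mat \<Rightarrow> ('i, 'r) mat" where
  "ad a x = mat_mult a x - mat_mult x a"

definition entrywise :: "('r \<Rightarrow> 'r) \<Rightarrow> ('i, 'r) mat \<Rightarrow> ('i, 'r) mat" where
  "entrywise u x = (\<lambda>i j. u (x i j))"

lemma M_fin_subset_M_rcf: "(M_fin I :: ('i, 'r::zero) mat set) \<subseteq> M_rcf I"
proof
  fix a :: "('i, 'r) mat" assume a: "a \<in> M_fin I"
  then have f: "finite {(i, j). a i j \<noteq> 0}" by (simp add: M_fin_def)
  have "finite {j. a i j \<noteq> 0}" for i
    by (rule finite_subset[OF _ finite_imageI[OF f, of snd]]) force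
  moreover have "finite {i. a i j \<noteq> 0}" for j
    by (rule finite_subset[OF _ finite_imageI[OF f, of fst]]) force
  ultimately show "a \<in> M_rcf I" using a by (simp add: M_fin_def M_rcf_def)
qed

lemma M_rcf_subset_M_cf: "M_rcf I \<subseteq> M_cf I"
  by (auto simp: M_rcf_def M_cf_def)

lemma mat_mult_nonzeroD:
  assumes "mat_mult a b i j \<noteq> 0"
  obtains k where "a i k \<noteq> 0" "b k j \<noteq> 0"
proof -
  have "\<exists>k. a i k * b k j \<noteq> 0"
  proof (rule ccontr)
    assume "\<not> ?thesis"
    then have "mat_mult a b i j = Sum_any (\<lambda>k. 0)" by (simp add: mat_mult_def)
    then show False using assms by simp
  qed
  then show ?thesis using that by (metis mult_zero_left mult_zero_right)
qed

lemma mat_mult_matrices: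
  "a \<in> matrices I \<Longrightarrow> b \<in> matrices I \<Longrightarrow> mat_mult a b \<in> matrices I"
  by (auto simp: matrices_def elim!: mat_mult_nonzeroD)

lemma mat_mult_finite_col:
  assumes "\<And>j. finite {i. a i j \<noteq> 0}" "\<And>j. finite {i. b i j \<noteq> 0}"
  shows "finite {i. mat_mult a b i j \<noteq> 0}"
  by (rule finite_subset[of _ "\<Union>k\<in>{k. b k j \<noteq> 0}. {i. a i k \<noteq> 0}"])
     (auto simp: assms elim!: mat_mult_nonzeroD)

lemma mat_mult_finite_row:
  assumes "\<And>i. finite {j. a i j \<noteq> 0}" "\<And>i. finite {j. b i j \<noteq> 0}"
  shows "finite {j. mat_mult a b i j \<noteq> 0}"
  by (rule finite_subset[of _ "\<Union>k\<in>{k. a i k \<noteq> 0}. {j. b k j \<noteq> 0}"])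
     (auto simp: assms elim!: mat_mult_nonzeroD)

lemma mat_mult_M_cf: "a \<in> M_cf I \<Longrightarrow> b \<in> M_cf I \<Longrightarrow> mat_mult a b \<in> M_cf I"
  by (simp add: M_cf_def mat_mult_matrices mat_mult_finite_col)

lemma mat_mult_M_rcf: "a \<in> M_rcf I \<Longrightarrow> b \<in> M_rcf I \<Longrightarrow> mat_mult a b \<in> M_rcf I"
  by (simp add: M_rcf_def mat_mult_matrices mat_mult_finite_col mat_mult_finite_row)

lemma mat_mult_M_fin_ideal:
  assumes a: "a \<in> M_rcf I" and b: "b \<in> M_fin I"
  shows "mat_mult a b \<in> M_fin I" "mat_mult b a \<in> M_fin I"
proof -
  have f: "finite {(i, j). b i j \<noteq> 0}" using b by (simp add: M_fin_def)
  have m: "a \<in> matrices I" "b \<in> matrices I"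
    and r: "\<And>i. finite {j. a i j \<noteq> 0}" and c: "\<And>j. finite {i. a i j \<noteq> 0}"
    using a b by (auto simp: M_rcf_def M_fin_def)
  have "finite (\<Union>(k, j)\<in>{(i, j). b i j \<noteq> 0}. {i. a i k \<noteq> 0} \<times> {j})"
    using f c by (intro finite_UN_I) auto
  then have "finite {(i, j). mat_mult a b i j \<noteq> 0}"
    by (rule rev_finite_subset) (auto elim!: mat_mult_nonzeroD)
  then show "mat_mult a b \<in> M_fin I" using m by (simp add: M_fin_def mat_mult_matrices)
  have "finite (\<Union>(i, k)\<in>{(i, j). b i j \<noteq> 0}. {i} \<times> {j. a k j \<noteq> 0})"
    using f r by (intro finite_UN_I) auto
  then have "finite {(i, j). mat_mult b a i j \<noteq> 0}"
    by (rule rev_finite_subset) (auto elim!: mat_mult_nonzeroD)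
  then show "mat_mult b a \<in> M_fin I" using m by (simp add: M_fin_def mat_mult_matrices)
qed

end

theory Submission
  imports Defs
begin

text \<open>
  Fix \<open>p \<in> I\<close> and write \<open>E\<^sub>i\<^sub>j\<close> for the matrix units. All three rings are handled at once: applying
  \<open>d\<close> to \<open>E\<^sub>p\<^sub>i x E\<^sub>j\<^sub>p = x\<^sub>i\<^sub>j E\<^sub>p\<^sub>p\<close> and comparing the \<open>(p, p)\<close> entries expresses
  \<open>(d x)\<^sub>i\<^sub>j\<close> as \<open>u(x\<^sub>i\<^sub>j) + (a x - x a)\<^sub>i\<^sub>j\<close>, where \<open>u(r) = d(r E\<^sub>p\<^sub>p)\<^sub>p\<^sub>p\<close> and
  \<open>a\<^sub>i\<^sub>j = d(E\<^sub>j\<^sub>p)\<^sub>i\<^sub>p\<close>. Applying \<open>d\<close> to \<open>E\<^sub>p\<^sub>i E\<^sub>j\<^sub>p\<close>, which is \<open>E\<^sub>p\<^sub>p\<close> or \<open>0\<close>, gives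
  \<open>a\<^sub>i\<^sub>j = - d(E\<^sub>p\<^sub>i)\<^sub>p\<^sub>j\<close>, because \<open>d(E\<^sub>p\<^sub>p)\<^sub>p\<^sub>p = 0\<close>. So the columns of \<open>a\<close> are columns, and its
  rows are up to sign rows, of matrices in the given ring, and \<open>a\<close> inherits its finiteness
  conditions.
\<close>

definition single :: "'i \<Rightarrow> 'i \<Rightarrow> 'r::zero \<Rightarrow> ('i, 'r) mat" where
  "single i j r k l = (if k = i \<and> l = j then r else 0)"

lemma single_M_fin: "i \<in> I \<Longrightarrow> j \<in> I \<Longrightarrow> single i j r \<in> M_fin I"
proof -
  assume "i \<in> I" "j \<in> I"
  moreover have "finite {(k, l). single i j r k l \<noteq> 0}"
    by (rule finite_subset[of _ "{(i, j)}"]) (auto simp: single_def)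
  ultimately show ?thesis by (simp add: M_fin_def matrices_def single_def)
qed

lemma single_add: "single i j (r + s :: 'r::monoid_add) = single i j r + single i j s"
  by (auto simp: single_def fun_eq_iff)

lemma Sum_any_eq_single:
  assumes "\<And>k. k \<noteq> i \<Longrightarrow> f k = 0"
  shows "Sum_any f = f i"
proof -
  have "f = (\<lambda>k. if k = i then f i else 0)" using assms by auto
  then have "Sum_any f = Sum_any (\<lambda>k. if k = i then f i else 0)" by (rule arg_cong)
  then show ?thesis by simp
qed

lemma mat_mult_single_left:
  "mat_mult (single i j r) b k l = (if k = i then r * b j l else 0)"
  using Sum_any_eq_single[of j "\<lambda>m. single i j r k m * b m l"]
  by (auto simp: mat_mult_def single_def)

lemma mat_mult_single_right:
  "mat_mult b (single i j r) k l = (if l = j then b k i * r else 0)"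
  using Sum_any_eq_single[of i "\<lambda>m. b k m * single i j r m l"]
  by (auto simp: mat_mult_def single_def)

lemmas mat_mult_single = mat_mult_single_left mat_mult_single_right

lemma single_mult_single:
  "mat_mult (single i j r) (single j l s) = single i l (r * s)"
  by (auto simp: fun_eq_iff mat_mult_single single_def)

text \<open>Negation preserves the support, and for an infinite support both sides are
  \<open>0\<close>.\<close>

lemma Sum_any_uminus: "Sum_any (\<lambda>k. - f k :: 'r::ab_group_add) = - Sum_any f"
  by (simp add: Sum_any.expand_set sum_negf)

text \<open>Here \<open>A\<close> abstracts the three rings. Row finiteness of \<open>a\<close> is
  concluded conditionally, so that one statement also serves \<open>M_cf I\<close>.\<close>

lemma derivation_eq_ad_plus_entrywise:
  fixes A :: "('i, 'r::{ring, monoid_mult}) mat set"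
  assumes p: "p \<in> I"
    and fin: "M_fin I \<subseteq> A" and cf: "A \<subseteq> M_cf I"
    and mult: "\<And>x y. x \<in> A \<Longrightarrow> y \<in> A \<Longrightarrow> mat_mult x y \<in> A"
    and d: "d \<in> Der A mat_mult"
  obtains a u where "a \<in> M_cf I" "A \<subseteq> M_rcf I \<Longrightarrow> a \<in> M_rcf I" "u \<in> Der UNIV (*)"
    "\<And>x. x \<in> A \<Longrightarrow> d x = ad a x + entrywise u x"
proof -
  have dA: "d x \<in> A" if "x \<in> A" for x using d that by (auto simp: Der_def)
  have dadd: "d (x + y) = d x + d y" if "x \<in> A" "y \<in> A" for x y
    using d that by (simp add: Der_def)
  have dmult: "d (mat_mult x y) = mat_mult (d x) y + mat_mult x (d y)"
    if "x \<in> A" "y \<in> A" for x y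
    using d that by (simp add: Der_def)
  have out: "x i j = 0" if "x \<in> A" "i \<notin> I \<or> j \<notin> I" for x i j
    using that cf by (auto simp: M_cf_def matrices_def)
  have sA: "single i j r \<in> A" if "i \<in> I" "j \<in> I" for i j r
    using fin single_M_fin[OF that] by blast
  define u where "u r = d (single p p r) p p" for r
  \<comment> \<open>For \<open>j\<close> outside \<open>I\<close>, \<open>single j p 1\<close> may
    lie outside \<open>A\<close>, where \<open>d\<close> is unconstrained; hence the default
    \<open>0\<close>.\<close>
  define a where "a i j = (if j \<in> I then d (single j p 1) i p else 0)" for i j
  have u_add: "u (r + s) = u r + u s" for r s
    using p by (simp add: u_def single_add dadd sA)
  have u0: "u 0 = 0" using u_add[of 0 0] by simp
  have u_mult: "u (r * s) = u r * s + r * u s" for r s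
    using dmult[of "single p p r" "single p p s"] p
    by (simp add: u_def sA single_mult_single mat_mult_single)
  have u: "u \<in> Der UNIV (*)" by (simp add: Der_def u_add u_mult)
  have u1: "u 1 = 0" using u_mult[of 1 1] by simp
  have key: "u (x i j) = mat_mult (d (single p i 1)) x p j + d x i j + mat_mult x a i j"
    if x: "x \<in> A" and ij: "i \<in> I" "j \<in> I" for x i j
  proof -
    let ?y = "mat_mult (single p i 1) x"
    have y: "?y \<in> A" using mult sA p ij x by blast
    have "single p p (x i j) = mat_mult ?y (single j p 1)"
      by (auto simp: fun_eq_iff mat_mult_single single_def)
    then have "u (x i j) = d ?y p j + mat_mult ?y (d (single j p 1)) p p"
      using y ij p by (simp add: u_def dmult sA mat_mult_single)
    also have "d ?y p j = mat_mult (d (single p i 1)) x p j + d x i j"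
      using x ij p by (simp add: dmult sA mat_mult_single)
    \<comment> \<open>Row \<open>p\<close> of \<open>?y\<close> is row \<open>i\<close> of
      \<open>x\<close>, and column \<open>p\<close> of \<open>d (single j p 1)\<close> is column
      \<open>j\<close> of \<open>a\<close>, so the sums agree term by term.\<close>
    also have "mat_mult ?y (d (single j p 1)) p p = mat_mult x a i j"
      using ij by (simp add: mat_mult_def[of ?y] mat_mult_def[of x] mat_mult_single a_def)
    finally show ?thesis .
  qed
  have a_row: "a i j = - d (single p i 1) p j" if i: "i \<in> I" for i j
  proof (cases "j \<in> I")
    case True
    have "mat_mult (single p i 1) (single j p 1) = single p p (if i = j then 1 else 0 :: 'r)"
      by (auto simp: fun_eq_iff mat_mult_single single_def)
    then have "u (if i = j then 1 else 0) = d (single p i 1) p j + d (single j p 1) i p"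
      using dmult[of "single p i 1" "single j p 1"] i True p
      by (simp add: u_def sA mat_mult_single)
    then show ?thesis using True u0 u1
      by (auto simp: a_def eq_neg_iff_add_eq_0 add.commute split: if_splits)
  next
    case False
    then show ?thesis using out[OF dA[OF sA[OF p i]]] by (simp add: a_def)
  qed
  have a_out: "a i j = 0" if "i \<notin> I \<or> j \<notin> I" for i j
    using that out[OF dA[OF sA[of j p 1]]] p by (auto simp: a_def)
  have am: "a \<in> matrices I" using a_out by (auto simp: matrices_def)
  have ac: "finite {i. a i j \<noteq> 0}" for j
    using cf dA[OF sA[of j p 1]] p by (cases "j \<in> I") (auto simp: a_def M_cf_def)
  have ar: "finite {j. a i j \<noteq> 0}" if "A \<subseteq> M_rcf I" for i
    using that dA[OF sA[of p i 1]] p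
    by (cases "i \<in> I") (auto simp: a_row a_out M_rcf_def)
  have "d x i j = (ad a x + entrywise u x) i j" if x: "x \<in> A" for x i j
  proof (cases "i \<in> I \<and> j \<in> I")
    case True
    \<comment> \<open>This turns the first summand in \<open>key\<close> into
      \<open>- mat_mult a x i j\<close>; solving for \<open>d x i j\<close> then gives the
      claim.\<close>
    have "mat_mult a x i j = - mat_mult (d (single p i 1)) x p j"
      using True by (simp add: mat_mult_def a_row Sum_any_uminus)
    then show ?thesis using key[OF x, of i j] True
      by (simp add: ad_def entrywise_def)
  next
    case False
    \<comment> \<open>Outside \<open>I \<times> I\<close> both sides vanish; for the entrywise term
      this is \<open>u 0 = 0\<close>.\<close>
    have "x \<in> matrices I" using x cf by (auto simp: M_cf_def)
    then have "mat_mult a x \<in> matrices I" "mat_mult x a \<in> matrices I"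
      using am by (simp_all add: mat_mult_matrices)
    then have "mat_mult a x i j = 0" "mat_mult x a i j = 0"
      using False unfolding matrices_def by blast+
    then show ?thesis using False out[OF x, of i j] out[OF dA[OF x], of i j] u0
      by (simp add: ad_def entrywise_def)
  qed
  then show thesis
    using that[of a u] am ac ar u by (auto simp: M_cf_def M_rcf_def fun_eq_iff)
qed

theorem theorem1:
  fixes I :: "'i set"
  assumes "infinite I"
  shows
    "(\<forall>d \<in> Der (M_fin I :: ('i, 'r::{ring, monoid_mult}) mat set) mat_mult.
        \<exists>a \<in> M_rcf I. \<exists>u \<in> Der UNIV (*).
          \<forall>x \<in> M_fin I. d x = ad a x + entrywise u x) \<and>
     (\<forall>d \<in> Der (M_cf I :: ('i, 'r) mat set) mat_mult.
        \<exists>a \<in> M_cf I. \<exists>u \<in> Der UNIV (*).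
          \<forall>x \<in> M_cf I. d x = ad a x + entrywise u x) \<and>
     (\<forall>d \<in> Der (M_rcf I :: ('i, 'r) mat set) mat_mult.
        \<exists>a \<in> M_rcf I. \<exists>u \<in> Der UNIV (*).
          \<forall>x \<in> M_rcf I. d x = ad a x + entrywise u x)"
proof -
  obtain p where p: "p \<in> I" using assms by (metis finite.emptyI ex_in_conv)
  have fin: "mat_mult x y \<in> M_fin I" if "x \<in> M_fin I" "y \<in> M_fin I" for x y :: "('i, 'r) mat"
    using that M_fin_subset_M_rcf mat_mult_M_fin_ideal(1) by blast
  note main = derivation_eq_ad_plus_entrywise[OF p]
  show ?thesis
  proof (intro conjI ballI)
    fix d assume "d \<in> Der (M_fin I :: ('i, 'r) mat set) mat_mult"
    \<comment> \<open>The matrix \<open>a\<close> need not lie in \<open>M_fin I\<close>: its single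
      rows and columns come from finite matrices, which gives only
      \<open>a \<in> M_rcf I\<close>.\<close>
    from main[OF order_refl order_trans[OF M_fin_subset_M_rcf M_rcf_subset_M_cf] fin this]
    show "\<exists>a \<in> M_rcf I. \<exists>u \<in> Der UNIV (*). \<forall>x \<in> M_fin I. d x = ad a x + entrywise u x"
      using M_fin_subset_M_rcf by metis
  next
    fix d assume "d \<in> Der (M_cf I :: ('i, 'r) mat set) mat_mult"
    from main[OF order_trans[OF M_fin_subset_M_rcf M_rcf_subset_M_cf] order_refl mat_mult_M_cf this]
    show "\<exists>a \<in> M_cf I. \<exists>u \<in> Der UNIV (*). \<forall>x \<in> M_cf I. d x = ad a x + entrywise u x"
      by metis
  next
    fix d assume "d \<in> Der (M_rcf I :: ('i, 'r) mat set) mat_mult"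
    from main[OF M_fin_subset_M_rcf M_rcf_subset_M_cf mat_mult_M_rcf this]
    show "\<exists>a \<in> M_rcf I. \<exists>u \<in> Der UNIV (*). \<forall>x \<in> M_rcf I. d x = ad a x + entrywise u x"
      by (metis order_refl)
  qed
qed

end
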